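(* Let $\boldsymbol{y}(t)=(p_1(t),p_2(t),\ldots,p_n(t))$, with $p_i(t)\in\mathbb{K}[t]$, be a polynomial parametrization of a curve $\mathcal{C}\subset \mathbb{K}^n$ such that $W(p_1,\ldots,p_n)\neq 0$ (i.e. the Wronskian is not identically zero), and let $\mathbf{d}$ be the degree of $\boldsymbol{y}(t)$. Then $W(p_1,\ldots,p_n)$ is a nonzero constant if and only if $\mathbf{d}=n-1$. Furthermore, in that case $\mathcal{C}$ is contained in a hyperplane of $\mathbb{K}^n$.
   Context: $\mathbb{K}$ is a field of characteristic zero, $n$ is a positive integer. The Wronskian $W(p_1,\ldots,p_n)\in\mathbb{K}[t]$ is the determinant of the $n\times n$ matrix whose entry in row $k$ and column $j$ is the $(k-1)$-th derivative $p_j^{(k-1)}(t)$. The degree of $\boldsymbol{y}(t)$ is the maximum of the degrees of the components $p_1(t),\ldots,p_n(t)$. A hyperplane means an affine hyperplane $\{\alpha_1x_1+\cdots+\alpha_nx_n=\alpha_0\}$ with $(\alpha_1,\ldots,\alpha_n)\neq 0$. *)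

theory Defs
  imports "Jordan_Normal_Form.Determinant" "HOL-Computational_Algebra.Polynomial"
begin

text \<open>Row and column indices of \<open>mat\<close> and \<open>vec\<close> start at 0, so row \<open>k\<close> holds the \<open>k\<close>-th
  derivatives. The parametrization is a vector of polynomials; its components are \<open>y $ j\<close>.\<close>

definition wronskian :: "'a::field_char_0 poly vec \<Rightarrow> 'a poly" where
  "wronskian y = det (mat (dim_vec y) (dim_vec y) (\<lambda>(k, j). (pderiv ^^ k) (y $ j)))"

text \<open>Only meaningful for \<open>dim_vec y > 0\<close>. The library convention \<open>degree 0 = 0\<close> does not
  affect the maximum as soon as some component is nonzero.\<close>

definition param_degree :: "'a::zero poly vec \<Rightarrow> nat" where
  "param_degree y = Max ((\<lambda>i. degree (y $ i)) ` {..<dim_vec y})"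

definition param_point :: "'a::comm_semiring_0 poly vec \<Rightarrow> 'a \<Rightarrow> 'a vec" where
  "param_point y t = map_vec (\<lambda>p. poly p t) y"

definition param_curve :: "'a::comm_semiring_0 poly vec \<Rightarrow> 'a vec set" where
  "param_curve y = range (param_point y)"

definition hyperplane :: "nat \<Rightarrow> 'a::field vec set \<Rightarrow> bool" where
  "hyperplane n H \<longleftrightarrow> (\<exists>a \<in> carrier_vec n. \<exists>a0. a \<noteq> 0\<^sub>v n \<and> H = {x \<in> carrier_vec n. a \<bullet> x = a0})"

end

theory Submission
  imports Defs
begin

text \<open>
  Adding a constant multiple of one component to another is a column operation on the Wronskian
  matrix, so it does not change \<open>W\<close>. Cancelling leading terms in this way until all degrees
  differ also preserves the maximal degree \<open>d\<close>: the component used to cancel keeps its degree.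
  So the components may be assumed to have distinct degrees \<open>d\<^sub>0, \<dots>, d\<^sub>n\<^sub>-\<^sub>1\<close>
  (\<open>exists_distinct_degrees\<close>).

  In that situation the degree of \<open>W\<close> can be read off (\<open>degree_wronskian_distinct_degrees\<close>).
  Multiply the row of \<open>k\<close>-th derivatives by \<open>t^k\<close>. The operator \<open>t^k D^k\<close> does not raise
  degrees and multiplies the leading coefficient of a polynomial of degree \<open>d\<close> by the falling
  factorial \<open>d (d - 1) \<dots> (d - k + 1)\<close>. Hence, up to the leading coefficients of the components,
  the coefficient of \<open>t^(\<Sum>\<^sub>j d\<^sub>j)\<close> in \<open>t^(0 + 1 + \<dots> + (n - 1)) W\<close> is a Vandermonde-like
  determinant of falling factorials at the distinct numbers \<open>d\<^sub>j\<close>. It is nonzero, so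
  \<open>deg W + (0 + 1 + \<dots> + (n - 1)) = \<Sum>\<^sub>j d\<^sub>j\<close>.

  Thus \<open>W\<close> is constant iff the \<open>n\<close> distinct naturals \<open>d\<^sub>j\<close> have the least possible sum, that
  is, iff they are \<open>0, \<dots>, n - 1\<close>, that is, iff their maximum is \<open>n - 1\<close>
  (\<open>sum_eq_sum_lessThan_card_iff\<close>).

  The hyperplane is a matter of counting: if all degrees are below \<open>n\<close>, then requiring the
  coefficients of \<open>t, \<dots>, t^(n - 1)\<close> to vanish in a linear combination of the \<open>n\<close> components
  gives \<open>n - 1\<close> linear equations, which have a nonzero solution.
\<close>

section \<open>Determinants\<close>

lemma det_scale_rows_cols:
  fixes f :: "nat \<Rightarrow> nat \<Rightarrow> 'a::comm_ring_1"
  shows "det (mat n n (\<lambda>(i, j). a i * f i j * b j))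
    = (\<Prod>i<n. a i) * det (mat n n (\<lambda>(i, j). f i j)) * (\<Prod>j<n. b j)"
proof -
  have "(\<Prod>i = 0..<n. a i * f i (p i) * b (p i))
      = (\<Prod>i<n. a i) * (\<Prod>i = 0..<n. f i (p i)) * (\<Prod>j<n. b j)"
    if "p permutes {0..<n}" for p
    using prod.permute[OF that, of b]
    by (simp add: prod.distrib lessThan_atLeast0 o_def)
  moreover have "p i < n" if "p permutes {0..<n}" "i < n" for p i
    using permutes_in_image[OF that(1), of i] that(2) by simp
  ultimately show ?thesis
    by (simp add: det_def'[of _ n] sum_distrib_left sum_distrib_right mult_ac)
qed

lemma
  fixes f :: "nat \<Rightarrow> nat \<Rightarrow> 'a::comm_ring_1 poly"
  assumes deg: "\<And>i j. i < n \<Longrightarrow> j < n \<Longrightarrow> degree (f i j) \<le> d j"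
  shows degree_det_le_column_bounds:
      "degree (det (mat n n (\<lambda>(i, j). f i j))) \<le> (\<Sum>j<n. d j)"
    and coeff_det_column_bounds:
      "coeff (det (mat n n (\<lambda>(i, j). f i j))) (\<Sum>j<n. d j)
        = det (mat n n (\<lambda>(i, j). coeff (f i j) (d j)))"
proof -
  have prod_bound: "degree (\<Prod>i\<in>A. q i) \<le> (\<Sum>i\<in>A. e i)
      \<and> coeff (\<Prod>i\<in>A. q i) (\<Sum>i\<in>A. e i) = (\<Prod>i\<in>A. coeff (q i) (e i))"
    if "finite A" "\<And>i. i \<in> A \<Longrightarrow> degree (q i) \<le> e i"
    for A and q :: "nat \<Rightarrow> 'a poly" and e
    using that
  proof (induction A rule: finite_induct)
    case (insert x A)
    have IH: "degree (prod q A) \<le> sum e A" "coeff (prod q A) (sum e A) = (\<Prod>i\<in>A. coeff (q i) (e i))"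
      using insert by auto
    have qx: "degree (q x) \<le> e x"
      using insert by auto
    have "degree (q x * prod q A) \<le> e x + sum e A"
      using degree_mult_le[of "q x" "prod q A"] IH(1) qx by linarith
    moreover have "coeff (q x * prod q A) (e x + sum e A) = coeff (q x) (e x) * coeff (prod q A) (sum e A)"
    proof -
      have z: "coeff (q x) i * coeff (prod q A) (e x + sum e A - i) = 0"
        if "i \<le> e x + sum e A" "i \<noteq> e x" for i
      proof (cases "i < e x")
        case True
        then show ?thesis using IH(1) by (simp add: coeff_eq_0)
      next
        case False
        then show ?thesis using qx that by (simp add: coeff_eq_0)
      qed
      have "coeff (q x * prod q A) (e x + sum e A)
          = (\<Sum>i\<in>{e x}. coeff (q x) i * coeff (prod q A) (e x + sum e A - i))"
        unfolding coeff_mult by (rule sum.mono_neutral_right) (use z in auto)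
      then show ?thesis by simp
    qed
    ultimately show ?case
      using insert.hyps IH(2) by simp
  qed auto
  let ?P = "{p. p permutes {0..<n}}"
  have perm: "p i < n" if "p permutes {0..<n}" "i < n" for p i
    using permutes_in_image[OF that(1), of i] that(2) by simp
  have term_bound: "degree (\<Prod>i = 0..<n. f i (p i)) \<le> (\<Sum>j<n. d j)"
      "coeff (\<Prod>i = 0..<n. f i (p i)) (\<Sum>j<n. d j) = (\<Prod>i = 0..<n. coeff (f i (p i)) (d (p i)))"
    if "p \<in> ?P" for p
  proof -
    have p: "p permutes {0..<n}" using that by simp
    have "(\<Sum>i = 0..<n. d (p i)) = (\<Sum>j<n. d j)"
      using sum.permute[OF p, of d] by (simp add: lessThan_atLeast0 o_def)
    then show "degree (\<Prod>i = 0..<n. f i (p i)) \<le> (\<Sum>j<n. d j)"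
      "coeff (\<Prod>i = 0..<n. f i (p i)) (\<Sum>j<n. d j) = (\<Prod>i = 0..<n. coeff (f i (p i)) (d (p i)))"
      using prod_bound[of "{0..<n}" "\<lambda>i. f i (p i)" "\<lambda>i. d (p i)"] deg perm[OF p] by auto
  qed
  have leibniz: "det (mat n n (\<lambda>(i, j). f i j)) = (\<Sum>p\<in>?P. signof p * (\<Prod>i = 0..<n. f i (p i)))"
    by (subst det_def'[of _ n]) (auto intro!: sum.cong prod.cong simp: perm)
  have coeff_sign: "coeff (signof p * q) m = signof p * coeff q m"
    for p and q :: "'a poly" and m
    by (cases p rule: sign_cases) auto
  have degree_sign: "degree (signof p * q) = degree q" for p and q :: "'a poly"
    by (cases p rule: sign_cases) auto
  show "degree (det (mat n n (\<lambda>(i, j). f i j))) \<le> (\<Sum>j<n. d j)"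
    unfolding leibniz
    by (rule degree_sum_le) (use term_bound(1) in \<open>auto simp: finite_permutations degree_sign\<close>)
  show "coeff (det (mat n n (\<lambda>(i, j). f i j))) (\<Sum>j<n. d j)
      = det (mat n n (\<lambda>(i, j). coeff (f i j) (d j)))"
    unfolding leibniz coeff_sum
    by (subst det_def'[of _ n])
      (auto intro!: sum.cong prod.cong simp: perm coeff_sign term_bound(2))
qed

text \<open>
  A generalized Vandermonde determinant: a linear dependency between the rows would be a nonzero
  polynomial of degree less than \<open>n\<close> that vanishes at \<open>n\<close> points.
\<close>

lemma det_poly_eval_nonzero:
  fixes q :: "nat \<Rightarrow> 'a::field poly"
  assumes deg: "\<And>k. k < n \<Longrightarrow> q k \<noteq> 0 \<and> degree (q k) = k"
    and inj: "inj_on x {..<n}"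
  shows "det (mat n n (\<lambda>(k, j). poly (q k) (x j))) \<noteq> 0"
proof
  let ?A = "mat n n (\<lambda>(k, j). poly (q k) (x j))"
  assume "det ?A = 0"
  then have "det (?A\<^sup>T) = 0"
    by (subst det_transpose[of _ n]) auto
  then obtain v where v: "v \<in> carrier_vec n" "v \<noteq> 0\<^sub>v n" "?A\<^sup>T *\<^sub>v v = 0\<^sub>v n"
    using det_0_iff_vec_prod_zero_field[of "?A\<^sup>T" n] by auto
  define P where "P = (\<Sum>k<n. smult (v $ k) (q k))"
  have "poly P (x j) = 0" if "j < n" for j
  proof -
    have "0 = (?A\<^sup>T *\<^sub>v v) $ j" using v(3) that by simp
    also have "\<dots> = (\<Sum>k<n. poly (q k) (x j) * v $ k)"
      using that v(1) by (simp add: scalar_prod_def lessThan_atLeast0)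
    finally show ?thesis
      unfolding P_def by (simp add: poly_sum mult.commute)
  qed
  moreover have "card (x ` {..<n}) = n" using inj by (simp add: card_image)
  moreover have "n > 0" using v(1,2) by (cases n) auto
  moreover have "degree P < n"
    unfolding P_def using deg \<open>n > 0\<close> by (intro degree_sum_less) (auto simp: degree_smult_eq)
  ultimately have P0: "P = 0"
    by (intro poly_eqI_degree[of "x ` {..<n}"]) auto
  \<comment> \<open>The last nonzero coefficient of the dependency survives as a coefficient of \<open>P\<close>.\<close>
  define K where "K = {k. k < n \<and> v $ k \<noteq> 0}"
  have "K \<noteq> {}" using v(1,2) by (auto simp: K_def intro!: eq_vecI)
  moreover have fin: "finite K" by (auto simp: K_def)
  ultimately have M: "Max K \<in> K" by (rule Max_in[rotated])
  then have Mn: "Max K < n" "v $ Max K \<noteq> 0" by (auto simp: K_def)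
  have "coeff (smult (v $ k) (q k)) (Max K) = 0" if "k < n" "k \<noteq> Max K" for k
  proof (cases "k < Max K")
    case True
    then show ?thesis using deg[OF that(1)] by (simp add: coeff_eq_0)
  next
    case False
    then have "k \<notin> K" using Max_ge[OF fin, of k] that by auto
    then show ?thesis using that by (simp add: K_def)
  qed
  then have "coeff P (Max K) = (\<Sum>k\<in>{Max K}. coeff (smult (v $ k) (q k)) (Max K))"
    unfolding P_def coeff_sum by (intro sum.mono_neutral_right) (use Mn in auto)
  also have "\<dots> \<noteq> 0"
    using Mn deg[OF Mn(1)] leading_coeff_0_iff[of "q (Max K)"] by simp
  finally show False using P0 by simp
qed

section \<open>The degree of a Wronskian\<close>

definition falling_factorial_poly :: "nat \<Rightarrow> 'a::comm_ring_1 poly" where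
  "falling_factorial_poly k = (\<Prod>i<k. [:- of_nat i, 1:])"

lemma falling_factorial_poly_nonzero: "falling_factorial_poly k \<noteq> (0 :: 'a::field poly)"
  by (simp add: falling_factorial_poly_def)

lemma degree_falling_factorial_poly: "degree (falling_factorial_poly k :: 'a::field poly) = k"
  unfolding falling_factorial_poly_def by (subst degree_prod_sum_eq) auto

lemma poly_falling_factorial_poly_of_nat:
  "poly (falling_factorial_poly k) (of_nat d :: 'a::field_char_0)
    = (if k \<le> d then pochhammer (of_nat (Suc (d - k))) k else 0)"
proof (cases "k \<le> d")
  case True
  have "poly (falling_factorial_poly k) (of_nat d :: 'a) = fact k * (of_nat d gchoose k)"
    by (simp add: falling_factorial_poly_def poly_prod gbinomial_prod_rev lessThan_atLeast0)
  also have "\<dots> = pochhammer (of_nat (Suc (d - k))) k"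
    using True by (simp add: gbinomial_pochhammer' of_nat_diff add.commute)
  finally show ?thesis using True by simp
next
  case False
  then show ?thesis
    by (auto simp: falling_factorial_poly_def poly_prod)
qed

lemma degree_monom_mult_higher_pderiv_le:
  fixes p :: "'a::field_char_0 poly"
  shows "degree (monom 1 k * (pderiv ^^ k) p) \<le> degree p"
  by (rule degree_le) (auto simp: coeff_monom_mult coeff_higher_pderiv coeff_eq_0)

text \<open>
  The formula covers small degrees too: for \<open>d < k\<close> the derivative kills \<open>t^d\<close>, and the falling
  factorial vanishes at \<open>d\<close>.
\<close>

lemma coeff_monom_mult_higher_pderiv:
  fixes p :: "'a::field_char_0 poly"
  shows "coeff (monom 1 k * (pderiv ^^ k) p) d = poly (falling_factorial_poly k) (of_nat d) * coeff p d"
  by (simp add: coeff_monom_mult coeff_higher_pderiv poly_falling_factorial_poly_of_nat)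

text \<open>
  The factors \<open>t^k\<close> on the rows make the degree bound depend on the column only, so the top
  coefficient of the determinant is the determinant of the top coefficients.
\<close>

lemma degree_wronskian_distinct_degrees:
  fixes y :: "'a::field_char_0 poly vec"
  assumes y: "y \<in> carrier_vec n"
    and nz: "\<And>j. j < n \<Longrightarrow> y $ j \<noteq> 0"
    and inj: "inj_on (\<lambda>j. degree (y $ j)) {..<n}"
  shows "degree (wronskian y) + \<Sum>{..<n} = (\<Sum>j<n. degree (y $ j))"
proof -
  let ?d = "\<lambda>j. degree (y $ j)"
  let ?f = "\<lambda>k j. monom 1 k * (pderiv ^^ k) (y $ j)"
  have row_factor: "(\<Prod>k<m. monom 1 k) = (monom 1 (\<Sum>{..<m}) :: 'a poly)" for m
    by (induction m) (simp_all add: mult_monom add.commute)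
  have D: "det (mat n n (\<lambda>(k, j). ?f k j)) = monom 1 (\<Sum>{..<n}) * wronskian y"
    using det_scale_rows_cols[of n "\<lambda>k. monom 1 k" "\<lambda>k j. (pderiv ^^ k) (y $ j)" "\<lambda>_. 1"] y
    by (simp add: wronskian_def row_factor)
  have "coeff (monom 1 (\<Sum>{..<n}) * wronskian y) (\<Sum>j<n. ?d j)
      = det (mat n n (\<lambda>(k, j). coeff (?f k j) (?d j)))"
    unfolding D[symmetric]
    by (rule coeff_det_column_bounds) (rule degree_monom_mult_higher_pderiv_le)
  also have "\<dots> = det (mat n n (\<lambda>(k, j). 1 * poly (falling_factorial_poly k) (of_nat (?d j)) * lead_coeff (y $ j)))"
    by (simp add: coeff_monom_mult_higher_pderiv)
  also have "\<dots> = det (mat n n (\<lambda>(k, j). poly (falling_factorial_poly k) (of_nat (?d j)))) * (\<Prod>j<n. lead_coeff (y $ j))"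
    by (subst det_scale_rows_cols) simp
  also have "\<dots> \<noteq> 0"
    using det_poly_eval_nonzero[of n falling_factorial_poly "\<lambda>j. of_nat (?d j) :: 'a"] inj nz
    by (auto simp: falling_factorial_poly_nonzero degree_falling_factorial_poly inj_on_def)
  finally have nz_coeff: "coeff (monom 1 (\<Sum>{..<n}) * wronskian y) (\<Sum>j<n. ?d j) \<noteq> 0" .
  have "degree (monom 1 (\<Sum>{..<n}) * wronskian y) \<le> (\<Sum>j<n. ?d j)"
    unfolding D[symmetric]
    by (rule degree_det_le_column_bounds) (rule degree_monom_mult_higher_pderiv_le)
  then have "degree (monom 1 (\<Sum>{..<n}) * wronskian y) = (\<Sum>j<n. ?d j)"
    using le_degree[OF nz_coeff] by simp
  moreover have "wronskian y \<noteq> 0" using nz_coeff by auto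
  ultimately show ?thesis
    by (simp add: degree_mult_eq degree_monom_eq add.commute)
qed

section \<open>Reduction to distinct degrees\<close>

lemma wronskian_zero_component:
  assumes "j < dim_vec y" "y $ j = 0"
  shows "wronskian y = 0"
proof -
  let ?n = "dim_vec y"
  let ?A = "mat ?n ?n (\<lambda>(k, j). (pderiv ^^ k) (y $ j))"
  have "?A *\<^sub>v unit_vec ?n j = 0\<^sub>v ?n"
    using assms by (intro eq_vecI) auto
  then show ?thesis
    unfolding wronskian_def using assms(1)
    by (subst det_0_iff_vec_prod_zero[of _ ?n]) (auto intro!: exI[of _ "unit_vec ?n j"])
qed

lemma wronskian_add_component:
  fixes y :: "'a::field_char_0 poly vec"
  assumes "i < n" "j < n" "i \<noteq> j" and y: "y \<in> carrier_vec n"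
  shows "wronskian (vec n (\<lambda>k. if k = i then y $ i + smult c (y $ j) else y $ k)) = wronskian y"
proof -
  let ?A = "mat n n (\<lambda>(k, j). (pderiv ^^ k) (y $ j))"
  let ?z = "vec n (\<lambda>k. if k = i then y $ i + smult c (y $ j) else y $ k)"
  have "mat n n (\<lambda>(k, j). (pderiv ^^ k) (?z $ j)) = addcol [:c:] i j ?A"
    using assms by (intro eq_matI) (auto simp: higher_pderiv_add higher_pderiv_smult)
  then show ?thesis
    using assms det_addcol[of j n i ?A "[:c:]"] by (simp add: wronskian_def)
qed

text \<open>
  Cancelling the leading term of one of two components of equal degree lowers the sum of all
  degrees, so repeating it ends.
\<close>

lemma exists_distinct_degrees:
  fixes y :: "'a::field_char_0 poly vec"
  assumes "y \<in> carrier_vec n" "wronskian y \<noteq> 0"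
  obtains z where "z \<in> carrier_vec n" "wronskian z = wronskian y"
    "inj_on (\<lambda>j. degree (z $ j)) {..<n}" "param_degree z = param_degree y"
  using assms
proof (induction "\<Sum>j<n. degree (y $ j)" arbitrary: y thesis rule: less_induct)
  case less
  note y = \<open>y \<in> carrier_vec n\<close>
  show ?case
  proof (cases "inj_on (\<lambda>j. degree (y $ j)) {..<n}")
    case True
    then show ?thesis using less.prems by blast
  next
    case False
    then obtain i j where ij: "i < n" "j < n" "i \<noteq> j" and deg: "degree (y $ i) = degree (y $ j)"
      by (auto simp: inj_on_def)
    have nz: "y $ j \<noteq> 0"
      using wronskian_zero_component[of j y] ij y less.prems(3) by auto
    define c where "c = - (lead_coeff (y $ i) / lead_coeff (y $ j))"
    define q where "q = y $ i + smult c (y $ j)"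
    define z where "z = vec n (\<lambda>k. if k = i then q else y $ k)"
    have z: "z \<in> carrier_vec n" by (simp add: z_def)
    have zy: "z $ i = q" "\<And>k. k < n \<Longrightarrow> k \<noteq> i \<Longrightarrow> z $ k = y $ k"
      using ij by (auto simp: z_def)
    have W: "wronskian z = wronskian y"
      unfolding z_def q_def by (rule wronskian_add_component[OF ij y])
    \<comment> \<open>\<open>q = 0\<close> would leave no lower degree to reach, but it would make \<open>W\<close> vanish.\<close>
    have "q \<noteq> 0"
      using wronskian_zero_component[of i z] ij z W zy less.prems(3) by auto
    moreover have "degree q \<le> degree (y $ i)"
      unfolding q_def using deg by (intro degree_add_le) auto
    moreover have "coeff q (degree (y $ i)) = 0"
      using nz deg by (simp add: q_def c_def)
    ultimately have lt: "degree q < degree (y $ i)"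
      by (metis le_neq_implies_less leading_coeff_0_iff)
    have "(\<Sum>k<n. degree (z $ k)) < (\<Sum>k<n. degree (y $ k))"
      by (rule sum_strict_mono_ex1) (use ij lt zy in \<open>auto simp: z_def\<close>)
    moreover have "param_degree z = param_degree y"
    proof -
      have dims: "dim_vec z = n" "dim_vec y = n" using z y by auto
      let ?D = "(\<lambda>k. degree (y $ k)) ` {..<n}"
      have ne: "?D \<noteq> {}" "finite ?D" using ij by auto
      have le: "degree (y $ k) \<le> Max ?D" if "k < n" for k
        using that by (intro Max_ge) auto
      obtain m where m: "m < n" "degree (y $ m) = Max ?D"
        using Max_in[OF ne(2,1)] by (metis (no_types, lifting) imageE lessThan_iff)
      have "Max ((\<lambda>k. degree (z $ k)) ` {..<n}) = Max ?D"
      proof (rule Max_eqI)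
        fix e assume "e \<in> (\<lambda>k. degree (z $ k)) ` {..<n}"
        then obtain k where k: "k < n" "e = degree (z $ k)" by auto
        show "e \<le> Max ?D"
        proof (cases "k = i")
          case True
          show ?thesis
            unfolding k(2) True zy(1) using less_le_trans[OF lt le[OF ij(1)]] by simp
        next
          case False
          then show ?thesis using le zy k by simp
        qed
      next
        \<comment> \<open>If the maximum was attained at \<open>i\<close>, it is still attained at \<open>j\<close>.\<close>
        define l where "l = (if m = i then j else m)"
        have "l < n" "degree (z $ l) = Max ?D"
          using m ij zy deg by (auto simp: l_def)
        then show "Max ?D \<in> (\<lambda>k. degree (z $ k)) ` {..<n}" by (metis imageI lessThan_iff)
      qed simp
      then show ?thesis by (simp add: param_degree_def dims)
    qed
    ultimately show ?thesis
      using less.hyps[of z] less.prems z W by metis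
  qed
qed

section \<open>Sets of naturals with least sum\<close>

lemma sum_lessThan_card_le:
  fixes S :: "nat set"
  assumes "finite S"
  shows "\<Sum>{..<card S} \<le> \<Sum>S"
  using assms
proof (induction S rule: finite_linorder_max_induct)
  case (insert b A)
  have "card A \<le> card {..<b}"
    by (rule card_mono) (use insert.hyps in auto)
  moreover have "b \<notin> A" using insert.hyps by auto
  ultimately show ?case using insert by simp
qed simp

text \<open>
  Without its maximum, \<open>S\<close> still has at least the least sum possible for its size. So if
  \<open>S\<close> itself has least sum, its maximum cannot exceed that of \<open>{..<card S}\<close>.
\<close>

lemma sum_eq_sum_lessThan_card_iff:
  fixes S :: "nat set"
  assumes S: "finite S" "S \<noteq> {}"
  shows "\<Sum>S = \<Sum>{..<card S} \<longleftrightarrow> Max S = card S - 1"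
proof -
  have pos: "card S > 0" using S by (simp add: card_gt_0_iff)
  have sub: "S \<subseteq> {..Max S}" using S by auto
  show ?thesis
  proof
    assume eq: "\<Sum>S = \<Sum>{..<card S}"
    have "Max S + \<Sum>{..<card S - 1} \<le> Max S + \<Sum>(S - {Max S})"
      using sum_lessThan_card_le[of "S - {Max S}"] S by simp
    also have "\<dots> = \<Sum>S"
      using S by (simp add: sum.remove[of S "Max S"])
    also have "\<dots> = \<Sum>{..<card S - 1} + (card S - 1)"
      using eq pos by (cases "card S") auto
    finally have "Max S \<le> card S - 1" by simp
    moreover have "card S \<le> Suc (Max S)"
      using card_mono[OF _ sub] by simp
    ultimately show "Max S = card S - 1" by simp
  next
    assume "Max S = card S - 1"
    then have "S \<subseteq> {..<card S}" using sub pos by (auto simp: subset_iff)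
    then have "S = {..<card S}" by (intro card_subset_eq) auto
    then show "\<Sum>S = \<Sum>{..<card S}" by simp
  qed
qed

section \<open>Curves of small degree lie in a hyperplane\<close>

lemma param_curve_subset_hyperplane:
  fixes y :: "'a::field poly vec"
  assumes n: "n > 0" and y: "y \<in> carrier_vec n" and deg: "\<And>j. j < n \<Longrightarrow> degree (y $ j) < n"
  shows "\<exists>H. hyperplane n H \<and> param_curve y \<subseteq> H"
proof -
  \<comment> \<open>The equation for the constant coefficient is replaced by \<open>0 = 0\<close>, so that the matrix of the
    linear system is square and singular.\<close>
  let ?A = "mat n n (\<lambda>(i, j). if i = 0 then 0 else coeff (y $ j) i)"
  have "?A\<^sup>T *\<^sub>v unit_vec n 0 = 0\<^sub>v n"
    using n by (intro eq_vecI) auto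
  then have "det (?A\<^sup>T) = 0"
    using n by (subst det_0_iff_vec_prod_zero_field[of _ n]) (auto intro!: exI[of _ "unit_vec n 0"])
  then have "det ?A = 0"
    by (subst (asm) det_transpose[of _ n]) auto
  then obtain v where v: "v \<in> carrier_vec n" "v \<noteq> 0\<^sub>v n" "?A *\<^sub>v v = 0\<^sub>v n"
    using det_0_iff_vec_prod_zero_field[of ?A n] by auto
  define Q where "Q = (\<Sum>j<n. smult (v $ j) (y $ j))"
  have coeff0: "coeff Q i = 0" if "i > 0" for i
  proof (cases "i < n")
    case True
    have "0 = (?A *\<^sub>v v) $ i" using v(3) True by simp
    also have "\<dots> = (\<Sum>j<n. coeff (y $ j) i * v $ j)"
      using that True v(1) by (simp add: scalar_prod_def lessThan_atLeast0)
    finally show ?thesis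
      by (simp add: Q_def coeff_sum mult.commute)
  next
    case False
    have "coeff (y $ j) i = 0" if "j < n" for j
      using deg[OF that] False by (intro coeff_eq_0) linarith
    then show ?thesis by (simp add: Q_def coeff_sum)
  qed
  have "Q = [:coeff Q 0:]"
    by (rule poly_eqI) (use coeff0 in \<open>auto simp: coeff_pCons split: nat.splits\<close>)
  then have const: "poly Q t = coeff Q 0" for t
    by (metis mult_zero_right add.right_neutral poly_pCons poly_0)
  have "v \<bullet> param_point y t = coeff Q 0" for t
    using y const[of t]
    by (simp add: scalar_prod_def param_point_def Q_def poly_sum lessThan_atLeast0)
  then have "param_curve y \<subseteq> {x \<in> carrier_vec n. v \<bullet> x = coeff Q 0}"
    using y by (auto simp: param_curve_def param_point_def)
  then show ?thesis
    using v(1,2) unfolding hyperplane_def by blast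
qed

section \<open>Constant Wronskians\<close>

theorem theorem5:
  fixes n :: nat and y :: "'a::field_char_0 poly vec" and C :: "'a vec set"
  assumes "n > 0"
    and "y \<in> carrier_vec n"
    and "C = param_curve y"
    and "wronskian y \<noteq> 0"
  shows "((\<exists>c. c \<noteq> 0 \<and> wronskian y = [:c:]) \<longleftrightarrow> param_degree y = n - 1)
    \<and> (param_degree y = n - 1 \<longrightarrow> (\<exists>H. hyperplane n H \<and> C \<subseteq> H))"
proof (intro conjI impI)
  obtain z where z: "z \<in> carrier_vec n" "wronskian z = wronskian y"
      "inj_on (\<lambda>j. degree (z $ j)) {..<n}" "param_degree z = param_degree y"
    using exists_distinct_degrees[OF assms(2,4)] by blast
  define S where "S = (\<lambda>j. degree (z $ j)) ` {..<n}"
  have S: "finite S" "S \<noteq> {}" "card S = n" "Max S = param_degree y"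
      "\<Sum>S = (\<Sum>j<n. degree (z $ j))"
    using assms(1) z by (auto simp: S_def card_image sum.reindex param_degree_def)
  have "z $ j \<noteq> 0" if "j < n" for j
    using wronskian_zero_component[of j z] that z assms(4) by auto
  then have "degree (wronskian y) + \<Sum>{..<n} = \<Sum>S"
    using degree_wronskian_distinct_degrees[OF z(1) _ z(3)] z(2) S(5) by simp
  then have "degree (wronskian y) = 0 \<longleftrightarrow> \<Sum>S = \<Sum>{..<card S}"
    using S(3) by auto
  also have "\<dots> \<longleftrightarrow> param_degree y = n - 1"
    using sum_eq_sum_lessThan_card_iff[OF S(1,2)] S(3,4) by simp
  also have "degree (wronskian y) = 0 \<longleftrightarrow> (\<exists>c. c \<noteq> 0 \<and> wronskian y = [:c:])"
    using assms(4) by (metis degree_eq_zeroE degree_pCons_0 pCons_0_0)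
  finally show "(\<exists>c. c \<noteq> 0 \<and> wronskian y = [:c:]) \<longleftrightarrow> param_degree y = n - 1" .
next
  assume d: "param_degree y = n - 1"
  have "degree (y $ j) \<le> param_degree y" if "j < n" for j
    unfolding param_degree_def using that assms(2) by (intro Max_ge) auto
  then have "degree (y $ j) < n" if "j < n" for j
    using that d assms(1) by fastforce
  then show "\<exists>H. hyperplane n H \<and> C \<subseteq> H"
    using param_curve_subset_hyperplane[OF assms(1,2)] assms(3) by blast
qed

end
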